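(* Let $\nu>0$, $c>0$, $d>0$, $\mu>0$, $c\neq d$, and let $N_0$ be a constant. Then the solution $N(t)$, $t>0$, of the equation $$N(t)-N_0\,t^{\mu-1}E_{\nu,\mu}(-d^{\nu}t^{\nu})=-c^{\nu}\;{}_0D_t^{-\nu}N(t)$$ is given by the formula $$N(t)=N_0\,\frac{t^{\mu-\nu-1}}{c^{\nu}-d^{\nu}}\left[E_{\nu,\mu-\nu}(-d^{\nu}t^{\nu})-E_{\nu,\mu-\nu}(-c^{\nu}t^{\nu})\right].$$
   Context: The Riemann-Liouville fractional integral of order $\nu>0$ with lower limit $0$ is ${}_0D_t^{-\nu}f(t)=\frac{1}{\Gamma(\nu)}\int_0^t f(u)(t-u)^{\nu-1}\,du$. The generalized Mittag-Leffler function is $E_{\alpha,\beta}(z)=\sum_{n=0}^{\infty}\frac{z^n}{\Gamma(\alpha n+\beta)}$ for $\alpha>0$ and real $\beta$, with the usual convention $1/\Gamma(x)=0$ when $x$ is a non-positive integer. The unknown $N$ is a real-valued function of $t>0$, locally integrable on $[0,\infty)$, and $N_0$ is a real constant. *)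

theory Defs
  imports "HOL-Analysis.Analysis"
begin

text \<open>
  Functions of \<open>t > 0\<close> are represented by functions on all reals; none of the notions below
  depends on their values on \<open>t \<le> 0\<close> (a single point is a null set).
\<close>

definition locally_integrable_on_halfline :: "(real \<Rightarrow> real) \<Rightarrow> bool"
  where "locally_integrable_on_halfline f \<longleftrightarrow> (\<forall>T>0. f absolutely_integrable_on {0..T})"

text \<open>
  The Lebesgue integral of a non-integrable function is \<open>0\<close> by convention, so existence of the
  Riemann-Liouville integral at \<open>t\<close> is a separate predicate. For \<open>\<nu> < 1\<close> it does not follow at every
  \<open>t\<close> from local integrability of \<open>f\<close>. The value of the integrand at the endpoint \<open>u = t\<close> is
  irrelevant.
\<close>

definition rl_integral_exists :: "real \<Rightarrow> (real \<Rightarrow> real) \<Rightarrow> real \<Rightarrow> bool"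
  where "rl_integral_exists \<nu> f t \<longleftrightarrow>
    (\<lambda>u. f u * (t - u) powr (\<nu> - 1)) absolutely_integrable_on {0..t}"

definition rl_integral :: "real \<Rightarrow> (real \<Rightarrow> real) \<Rightarrow> real \<Rightarrow> real"
  where "rl_integral \<nu> f t =
    1 / Gamma \<nu> * (LINT u:{0..t}|lebesgue. f u * (t - u) powr (\<nu> - 1))"

text \<open>
  \<^const>\<open>rGamma\<close> is the reciprocal Gamma function, which vanishes at the non-positive integers.
\<close>

definition mittag_leffler :: "real \<Rightarrow> real \<Rightarrow> real \<Rightarrow> real"
  where "mittag_leffler \<alpha> \<beta> z = (\<Sum>n. z ^ n * rGamma (\<alpha> * real n + \<beta>))"

end

theory Submission
  imports Defs
begin

text \<open>
  Put \<open>e \<beta> x t = t powr (\<beta> - 1) * mittag_leffler \<nu> \<beta> (x * t powr \<nu>)\<close>. These functions turn the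
  equation into algebra. Integrating the series term by term, where each term is an Euler Beta
  integral, shows that the Riemann-Liouville integral of order \<open>\<kappa>\<close> raises \<open>\<beta>\<close> to \<open>\<beta> + \<kappa>\<close>
  (\<open>rl_integral_mittag_leffler_kernel\<close>). Splitting off the first term of the series gives
  \<open>e (\<beta> - \<nu>) x = t powr (\<beta> - \<nu> - 1) * rGamma (\<beta> - \<nu>) + x * e \<beta> x\<close>
  (\<open>mittag_leffler_kernel_shift\<close>). With \<open>C = c powr \<nu>\<close> and \<open>D = d powr \<nu>\<close>, the shift cancels the
  possibly non-integrable leading powers in the claimed formula and turns it into
  \<open>M = N0 / (C - D) * (C * e \<mu> (- C) - D * e \<mu> (- D))\<close>, and applying it once more after integration
  gives \<open>N0 / (C - D) * (e \<mu> (- D) - e \<mu> (- C))\<close> for the integral of \<open>M\<close>. Hence \<open>M\<close> solves the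
  equation, whose source term is \<open>N0 * e \<mu> (- D)\<close>.

  The difference \<open>f\<close> of two solutions satisfies \<open>f = - C * rl_integral \<nu> f\<close>. In the weighted norm
  \<open>\<integral> \<bar>f t\<bar> * exp (- p * t)\<close> over \<open>[0, T]\<close> the operator \<open>rl_integral \<nu>\<close> has norm at most
  \<open>p powr (- \<nu>)\<close>, by Tonelli's theorem and the Laplace transform of \<open>t powr (\<nu> - 1)\<close>. For large \<open>p\<close>
  this makes the right-hand side a contraction, so \<open>f\<close> vanishes almost everywhere. The equation then
  gives \<open>f = 0\<close> at every \<open>t > 0\<close>, since its right-hand side ignores null sets
  (\<open>rl_homogeneous_unique\<close>).
\<close>

section \<open>Convergence of the Mittag-Leffler series\<close>

text \<open>
  Since \<open>s\<close> is arbitrary, \<open>Gamma\<close> outgrows every exponential, which is all that the convergence of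
  the Mittag-Leffler series needs. The bound comes from keeping only the part over \<open>[s, s + 1]\<close> of
  Euler's integral.
\<close>

lemma Gamma_ge_exponential:
  fixes s y :: real
  assumes "s > 0" "y \<ge> 1"
  shows "s powr (y - 1) * exp (- (s + 1)) \<le> Gamma y"
proof -
  let ?g = "\<lambda>t::real. t powr (y - 1) / exp t"
  have G: "(?g has_integral Gamma y) {0..}"
    using assms by (intro Gamma_integral_real) simp
  have cont: "continuous_on {s..s+1} ?g"
    using assms by (intro continuous_intros) auto
  have int: "?g integrable_on {s..s+1}"
    by (rule integrable_continuous_real[OF cont])
  have "s powr (y - 1) * exp (- (s + 1)) = integral {s..s+1} (\<lambda>t. s powr (y - 1) * exp (- (s + 1)))"
    by simp
  also have "\<dots> \<le> integral {s..s+1} ?g"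
  proof (rule integral_le)
    fix t assume t: "t \<in> {s..s+1}"
    have "s powr (y - 1) * exp (- (s + 1)) \<le> t powr (y - 1) * exp (- t)"
      using t assms by (intro mult_mono powr_mono2) auto
    then show "s powr (y - 1) * exp (- (s + 1)) \<le> ?g t"
      by (simp add: exp_minus field_simps)
  qed (use int in auto)
  also have "\<dots> \<le> integral {0..} ?g"
    using G assms int by (intro integral_subset_le) auto
  also have "\<dots> = Gamma y" using G by (rule integral_unique)
  finally show ?thesis .
qed

text \<open>
  The terms are eventually dominated by a geometric series whose ratio \<open>\<bar>z\<bar> / s powr \<alpha>\<close> can be made
  less than one by the choice of \<open>s\<close> in the lower bound for \<open>Gamma\<close>.
\<close>

lemma summable_mittag_leffler:
  fixes \<alpha> \<beta> z :: real
  assumes "\<alpha> > 0"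
  shows "summable (\<lambda>n. z ^ n * rGamma (\<alpha> * real n + \<beta>))"
proof -
  define s where "s = (\<bar>z\<bar> + 1) powr (1 / \<alpha>)"
  have s: "s > 0" by (simp add: s_def)
  have s\<alpha>: "s powr \<alpha> = (\<bar>z\<bar> + 1)" using assms by (simp add: s_def powr_powr)
  define q where "q = \<bar>z\<bar> / (\<bar>z\<bar> + 1)"
  have q: "0 \<le> q" "q < 1" by (auto simp: q_def)
  define K where "K = exp (s + 1) * s powr (1 - \<beta>)"
  obtain n0 :: nat where n0: "(1 - \<beta>) / \<alpha> \<le> real n0" using real_arch_simple by blast
  \<comment> \<open>The first terms may have a Gamma argument below one, even a pole, where the bound does not apply.\<close>
  have "norm (z ^ n * rGamma (\<alpha> * real n + \<beta>)) \<le> K * q ^ n" if n: "n \<ge> n0" for n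
  proof -
    let ?y = "\<alpha> * real n + \<beta>"
    have "(1 - \<beta>) / \<alpha> \<le> real n" using n n0 by linarith
    then have y: "?y \<ge> 1" using assms by (simp add: field_simps)
    have pos: "0 < s powr (?y - 1) * exp (- (s + 1))" using s by simp
    have "rGamma ?y = 1 / Gamma ?y" by (simp add: rGamma_inverse_Gamma divide_inverse)
    also have "\<dots> \<le> 1 / (s powr (?y - 1) * exp (- (s + 1)))"
      using Gamma_ge_exponential[OF s y] pos by (intro divide_left_mono mult_pos_pos) auto
    also have "\<dots> = K / s powr (\<alpha> * real n)"
    proof -
      have "s powr (?y - 1) * s powr (1 - \<beta>) = s powr (\<alpha> * real n)"
        by (simp add: powr_add[symmetric])
      then show ?thesis using s
        by (simp add: K_def field_simps flip: exp_add)
    qed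
    also have "s powr (\<alpha> * real n) = (\<bar>z\<bar> + 1) ^ n"
      using s by (simp add: s\<alpha>[symmetric] powr_powr[symmetric] powr_realpow)
    finally have "rGamma ?y \<le> K / (\<bar>z\<bar> + 1) ^ n" .
    moreover have "0 \<le> rGamma ?y" using y Gamma_real_pos[of ?y]
      by (simp add: rGamma_inverse_Gamma)
    ultimately have "\<bar>z\<bar> ^ n * rGamma ?y \<le> \<bar>z\<bar> ^ n * (K / (\<bar>z\<bar> + 1) ^ n)"
      by (intro mult_left_mono) auto
    with \<open>0 \<le> rGamma ?y\<close> show ?thesis
      by (simp add: abs_mult power_abs q_def power_divide mult_ac)
  qed
  moreover have "summable (\<lambda>n. K * q ^ n)" using q by (intro summable_mult summable_geometric) simp
  ultimately show ?thesis by (rule_tac summable_comparison_test[of _ "\<lambda>n. K * q ^ n"]) auto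
qed

text \<open>
  For large \<open>s\<close>, the Laplace transform of this function of \<open>t\<close> at \<open>s\<close> is \<open>s powr (\<alpha> - \<beta>) / (s powr \<alpha> - x)\<close> when
  \<open>\<alpha>\<close> and \<open>\<beta>\<close> are positive. Fractional integration divides by a power of \<open>s\<close>, which is why it acts
  on \<open>\<beta>\<close> alone.
\<close>

definition mittag_leffler_kernel :: "real \<Rightarrow> real \<Rightarrow> real \<Rightarrow> real \<Rightarrow> real"
  where "mittag_leffler_kernel \<alpha> \<beta> x t = t powr (\<beta> - 1) * mittag_leffler \<alpha> \<beta> (x * t powr \<alpha>)"

lemma mittag_leffler_kernel_sums:
  assumes "\<alpha> > 0" "t > 0"
  shows "(\<lambda>n. x ^ n * (rGamma (\<alpha> * real n + \<beta>) * t powr (\<alpha> * real n + \<beta> - 1))) sums mittag_leffler_kernel \<alpha> \<beta> x t"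
proof -
  have "(\<lambda>n. (x * t powr \<alpha>) ^ n * rGamma (\<alpha> * real n + \<beta>)) sums mittag_leffler \<alpha> \<beta> (x * t powr \<alpha>)"
    unfolding mittag_leffler_def by (intro summable_sums summable_mittag_leffler assms)
  from sums_mult[OF this, of "t powr (\<beta> - 1)"]
  have "(\<lambda>n. t powr (\<beta> - 1) * ((x * t powr \<alpha>) ^ n * rGamma (\<alpha> * real n + \<beta>))) sums mittag_leffler_kernel \<alpha> \<beta> x t"
    by (simp add: mittag_leffler_kernel_def)
  moreover have "t powr (\<beta> - 1) * ((x * t powr \<alpha>) ^ n * rGamma (\<alpha> * real n + \<beta>))
      = x ^ n * (rGamma (\<alpha> * real n + \<beta>) * t powr (\<alpha> * real n + \<beta> - 1))" for n
  proof -
    have "t powr (\<alpha> * real n + \<beta> - 1) = t powr (\<beta> - 1) * (t powr \<alpha>) ^ n"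
      using assms by (simp add: powr_powr powr_add[symmetric] powr_realpow[symmetric] algebra_simps)
    then show ?thesis by (simp add: power_mult_distrib mult_ac)
  qed
  ultimately show ?thesis by simp
qed

text \<open>
  Each later term of the series on the left is \<open>x\<close> times the preceding term of the series on the
  right; the first term is left over.
\<close>

lemma mittag_leffler_kernel_shift:
  assumes "\<alpha> > 0" "t > 0"
  shows "mittag_leffler_kernel \<alpha> (\<beta> - \<alpha>) x t = t powr (\<beta> - \<alpha> - 1) * rGamma (\<beta> - \<alpha>) + x * mittag_leffler_kernel \<alpha> \<beta> x t"
proof -
  let ?f = "\<lambda>n. x ^ n * (rGamma (\<alpha> * real n + (\<beta> - \<alpha>)) * t powr (\<alpha> * real n + (\<beta> - \<alpha>) - 1))"
  have "(\<lambda>n. x * (x ^ n * (rGamma (\<alpha> * real n + \<beta>) * t powr (\<alpha> * real n + \<beta> - 1)))) sums (x * mittag_leffler_kernel \<alpha> \<beta> x t)"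
    by (intro sums_mult mittag_leffler_kernel_sums assms)
  then have "(\<lambda>n. ?f (Suc n)) sums (x * mittag_leffler_kernel \<alpha> \<beta> x t)"
    by (simp add: algebra_simps)
  from sums_Suc[OF this] have "?f sums (x * mittag_leffler_kernel \<alpha> \<beta> x t + t powr (\<beta> - \<alpha> - 1) * rGamma (\<beta> - \<alpha>))"
    by (simp add: mult_ac)
  from sums_unique2[OF this mittag_leffler_kernel_sums[OF assms]] show ?thesis by simp
qed

section \<open>Riemann-Liouville integrals\<close>

text \<open>
  Rescaling \<open>[0, t]\<close> to \<open>[0, 1]\<close> gives the Beta integral, with the factor \<open>Gamma \<nu>\<close> cancelled by the
  normalisation of the fractional integral.
\<close>

lemma rl_integral_power:
  fixes a \<nu> t :: real
  assumes "a > 0" "\<nu> > 0" "t > 0"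
  shows "rl_integral_exists \<nu> (\<lambda>u. u powr (a - 1)) t"
    and "rl_integral \<nu> (\<lambda>u. u powr (a - 1)) t = Gamma a * rGamma (a + \<nu>) * t powr (a + \<nu> - 1)"
proof -
  let ?g = "\<lambda>s::real. s powr (a - 1) * (1 - s) powr (\<nu> - 1)"
  let ?h = "\<lambda>u::real. u powr (a - 1) * (t - u) powr (\<nu> - 1)"
  have "((\<lambda>u. ?g ((1 / t) *\<^sub>R u + 0)) has_integral Beta a \<nu> /\<^sub>R (1 / t) ^ DIM(real))
      (cbox ((0 - 0) /\<^sub>R (1 / t)) ((1 - 0) /\<^sub>R (1 / t)))"
    using has_integral_Beta_real[OF assms(1,2)] assms
    by (intro has_integral_affinity') auto
  then have "((\<lambda>u. ?g (u / t)) has_integral t * Beta a \<nu>) {0..t}"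
    by (simp add: field_simps)
  from has_integral_mult_right[OF this, of "t powr (a + \<nu> - 2)"]
  have "((\<lambda>u. t powr (a + \<nu> - 2) * ?g (u / t)) has_integral (t powr (a + \<nu> - 2) * (t * Beta a \<nu>))) {0..t}" .
  also have "t powr (a + \<nu> - 2) * (t * Beta a \<nu>) = Beta a \<nu> * t powr (a + \<nu> - 1)"
    using assms powr_add[of t "a + \<nu> - 2" 1] by (simp add: algebra_simps)
  finally have "((\<lambda>u. t powr (a + \<nu> - 2) * ?g (u / t)) has_integral Beta a \<nu> * t powr (a + \<nu> - 1)) {0..t}" .
  moreover have "t powr (a + \<nu> - 2) * ?g (u / t) = ?h u" if "u \<in> {0..t}" for u
  proof -
    have "1 - u / t = (t - u) / t" using assms by (simp add: field_simps)
    then have "?g (u / t) = ?h u / (t powr (a - 1) * t powr (\<nu> - 1))"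
      using that assms by (simp add: powr_divide)
    also have "t powr (a - 1) * t powr (\<nu> - 1) = t powr (a + \<nu> - 2)"
      by (simp add: powr_add[symmetric])
    finally show ?thesis using assms by simp
  qed
  ultimately have h: "(?h has_integral Beta a \<nu> * t powr (a + \<nu> - 1)) {0..t}"
    using has_integral_cong by (metis (no_types, lifting))
  then have ai: "?h absolutely_integrable_on {0..t}"
    by (intro nonnegative_absolutely_integrable_1) auto
  then show "rl_integral_exists \<nu> (\<lambda>u. u powr (a - 1)) t" by (simp add: rl_integral_exists_def)
  have "Gamma \<nu> \<noteq> 0" using Gamma_real_pos[OF assms(2)] by linarith
  moreover have "(LINT u:{0..t}|lebesgue. ?h u) = Beta a \<nu> * t powr (a + \<nu> - 1)"
    using set_lebesgue_integral_eq_integral(2)[OF ai] h by (simp add: integral_unique)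
  ultimately show "rl_integral \<nu> (\<lambda>u. u powr (a - 1)) t = Gamma a * rGamma (a + \<nu>) * t powr (a + \<nu> - 1)"
    by (simp add: rl_integral_def Beta_altdef)
qed

lemma rl_integral_cong:
  assumes "rl_integral_exists \<nu> f t" "\<And>u. u > 0 \<Longrightarrow> f u = g u"
  shows "rl_integral_exists \<nu> g t" and "rl_integral \<nu> g t = rl_integral \<nu> f t"
proof -
  let ?F = "\<lambda>u. f u * (t - u) powr (\<nu> - 1)" and ?G = "\<lambda>u. g u * (t - u) powr (\<nu> - 1)"
  have F: "?F absolutely_integrable_on {0..t}" using assms(1) by (simp add: rl_integral_exists_def)
  have FG: "?G u = ?F u" if "u \<in> {0..t} - {0}" for u using assms(2) that by auto
  then have G: "?G absolutely_integrable_on {0..t}"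
    by (intro absolutely_integrable_spike[OF F negligible_sing[of 0]])
  then show "rl_integral_exists \<nu> g t" by (simp add: rl_integral_exists_def)
  have "integral {0..t} ?F = integral {0..t} ?G"
    using FG by (intro integral_spike[OF negligible_sing[of 0]]) auto
  then show "rl_integral \<nu> g t = rl_integral \<nu> f t"
    unfolding rl_integral_def set_lebesgue_integral_eq_integral(2)[OF F] set_lebesgue_integral_eq_integral(2)[OF G]
    by simp
qed

text \<open>
  The kernel of order one is constant up to its value at \<open>u = t\<close>. Every existence result for
  fractional integrals therefore yields local integrability as a special case.
\<close>

lemma locally_integrable_on_halfline_iff_rl:
  "locally_integrable_on_halfline f \<longleftrightarrow> (\<forall>t>0. rl_integral_exists 1 f t)"
proof -
  have "f absolutely_integrable_on {0..t} \<longleftrightarrow> (\<lambda>u. f u * (t - u) powr (1 - 1)) absolutely_integrable_on {0..t}" for t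
    by (rule absolutely_integrable_spike_eq[of "{t}"]) auto
  then show ?thesis by (simp add: locally_integrable_on_halfline_def rl_integral_exists_def)
qed

lemma rl_integral_lincomb:
  assumes "rl_integral_exists \<nu> f t" "rl_integral_exists \<nu> g t"
  shows "rl_integral_exists \<nu> (\<lambda>u. a * f u + b * g u) t"
    and "rl_integral \<nu> (\<lambda>u. a * f u + b * g u) t = a * rl_integral \<nu> f t + b * rl_integral \<nu> g t"
proof -
  have eq: "(a * f u + b * g u) * (t - u) powr (\<nu> - 1)
      = a * (f u * (t - u) powr (\<nu> - 1)) + b * (g u * (t - u) powr (\<nu> - 1))" for u
    by (simp add: algebra_simps)
  note A = assms[unfolded rl_integral_exists_def]
  have B: "set_integrable lebesgue {0..t} (\<lambda>u. a * (f u * (t - u) powr (\<nu> - 1)))"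
          "set_integrable lebesgue {0..t} (\<lambda>u. b * (g u * (t - u) powr (\<nu> - 1)))"
    using A by auto
  show "rl_integral_exists \<nu> (\<lambda>u. a * f u + b * g u) t"
    unfolding rl_integral_exists_def eq by (rule set_integral_add(1)[OF B])
  show "rl_integral \<nu> (\<lambda>u. a * f u + b * g u) t = a * rl_integral \<nu> f t + b * rl_integral \<nu> g t"
    unfolding rl_integral_def eq set_integral_add(2)[OF B]
    by (simp add: algebra_simps)
qed

text \<open>
  Termwise integration is justified by absolute convergence: replacing \<open>x\<close> by \<open>\<bar>x\<bar>\<close> turns the series
  of norms into the series of the same kind at \<open>\<beta> + \<nu>\<close>, which converges. Positivity of \<open>\<beta>\<close> makes all
  powers integrable at the origin.
\<close>

lemma rl_integral_mittag_leffler_kernel: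
  assumes "\<alpha> > 0" "\<beta> > 0" "\<nu> > 0" "t > 0"
  shows "rl_integral_exists \<nu> (mittag_leffler_kernel \<alpha> \<beta> x) t"
    and "rl_integral \<nu> (mittag_leffler_kernel \<alpha> \<beta> x) t = mittag_leffler_kernel \<alpha> (\<beta> + \<nu>) x t"
proof -
  define a where "a n = \<alpha> * real n + \<beta>" for n
  have a: "a n > 0" for n using assms by (simp add: a_def add_nonneg_pos)
  have Ga: "Gamma (a n) > 0" for n using a by (rule Gamma_real_pos)
  have rGa: "rGamma (a n) * Gamma (a n) = 1" "rGamma (a n) > 0" for n
    using Ga[of n] by (auto simp: rGamma_inverse_Gamma)
  have G\<nu>: "Gamma \<nu> > 0" using assms by (intro Gamma_real_pos)
  define k where "k u = indicator {0..t} u * (t - u) powr (\<nu> - 1)" for u :: real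
  define f where "f n u = x ^ n * rGamma (a n) * (u powr (a n - 1) * k u)" for n u
  define v where "v n = rGamma (a n + \<nu>) * t powr (a n + \<nu> - 1)" for n
  have k_int: "integrable lebesgue (\<lambda>u. u powr (a n - 1) * k u)" for n
    using rl_integral_power(1)[OF a assms(3,4)]
    by (simp add: rl_integral_exists_def set_integrable_def k_def mult_ac)
  have k_val: "(\<integral>u. u powr (a n - 1) * k u \<partial>lebesgue) = Gamma \<nu> * (Gamma (a n) * v n)" for n
    using rl_integral_power(2)[OF a assms(3,4), of n] G\<nu>
    by (simp add: rl_integral_def set_lebesgue_integral_def k_def v_def field_simps)
  have f_int: "integrable lebesgue (f n)" for n
    unfolding f_def by (intro integrable_mult_right k_int)
  have f_val: "(\<integral>u. f n u \<partial>lebesgue) = Gamma \<nu> * (x ^ n * v n)" for n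
    using rGa(1)[of n] unfolding f_def integral_mult_right_zero k_val by (simp add: algebra_simps)
  have "k u \<ge> 0" for u by (simp add: k_def)
  then have norm_f: "norm (f n u) = \<bar>x\<bar> ^ n * rGamma (a n) * (u powr (a n - 1) * k u)" for n u
    using rGa(2)[of n] by (simp add: f_def abs_mult power_abs)
  have f_norm_val: "(\<integral>u. norm (f n u) \<partial>lebesgue) = Gamma \<nu> * (\<bar>x\<bar> ^ n * v n)" for n
    using rGa(1)[of n] unfolding norm_f integral_mult_right_zero k_val by (simp add: algebra_simps)
  have v_sums: "(\<lambda>n. y ^ n * v n) sums mittag_leffler_kernel \<alpha> (\<beta> + \<nu>) y t" for y
    using mittag_leffler_kernel_sums[OF assms(1,4), of y "\<beta> + \<nu>"] by (simp add: v_def a_def add_ac)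
  have f_sums: "(\<lambda>n. y ^ n * rGamma (a n) * (u powr (a n - 1) * k u)) sums (mittag_leffler_kernel \<alpha> \<beta> y u * k u)" for u y
  proof (cases "u > 0")
    case True
    from sums_mult2[OF mittag_leffler_kernel_sums[OF assms(1) this, of y \<beta>], of "k u"] show ?thesis
      by (simp add: a_def mult_ac)
  next
    case False
    \<comment> \<open>At the left endpoint every term and the sum vanish, because \<open>0 powr r = 0\<close> for every \<open>r\<close>.\<close>
    then have "u = 0 \<or> k u = 0" by (auto simp: k_def)
    then show ?thesis by (auto simp: mittag_leffler_kernel_def)
  qed
  have s1: "AE u in lebesgue. summable (\<lambda>n. norm (f n u))"
    unfolding norm_f by (intro AE_I2 sums_summable[OF f_sums])
  have s2: "summable (\<lambda>n. \<integral>u. norm (f n u) \<partial>lebesgue)"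
    unfolding f_norm_val by (intro summable_mult sums_summable[OF v_sums])
  let ?h = "\<lambda>u. indicat_real {0..t} u *\<^sub>R (mittag_leffler_kernel \<alpha> \<beta> x u * (t - u) powr (\<nu> - 1))"
  have "(\<Sum>n. f n u) = ?h u" for u
    using sums_unique[OF f_sums[of x u]] by (simp add: f_def k_def mult_ac)
  note I = integrable_suminf[OF f_int s1 s2, unfolded this] sums_integral[OF f_int s1 s2, unfolded this]
  show "rl_integral_exists \<nu> (mittag_leffler_kernel \<alpha> \<beta> x) t"
    unfolding rl_integral_exists_def set_integrable_def by (rule I(1))
  have "(\<integral>u. ?h u \<partial>lebesgue) = Gamma \<nu> * mittag_leffler_kernel \<alpha> (\<beta> + \<nu>) x t"
    by (rule sums_unique2[OF I(2)[unfolded f_val] sums_mult[OF v_sums]])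
  then show "rl_integral \<nu> (mittag_leffler_kernel \<alpha> \<beta> x) t = mittag_leffler_kernel \<alpha> (\<beta> + \<nu>) x t"
    using G\<nu> by (simp add: rl_integral_def set_lebesgue_integral_def)
qed

section \<open>Uniqueness for the homogeneous equation\<close>

lemma nn_integral_Laplace_power:
  fixes \<nu> p u :: real
  assumes "\<nu> > 0" "p > 0"
  shows "(\<integral>\<^sup>+t. ennreal (indicator {u..} t * ((t - u) powr (\<nu> - 1) * exp (- p * t))) \<partial>lborel)
     = ennreal (Gamma \<nu> * p powr (- \<nu>) * exp (- p * u))"
proof -
  let ?g = "\<lambda>t. ennreal (indicator {u..} t * ((t - u) powr (\<nu> - 1) * exp (- p * t)))"
  have "(\<integral>\<^sup>+t. ?g t \<partial>lborel) = ennreal \<bar>1 / p\<bar> * (\<integral>\<^sup>+s. ?g (u + (1 / p) * s) \<partial>lborel)"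
    using assms by (intro nn_integral_real_affine) auto
  also have "(\<integral>\<^sup>+s. ?g (u + (1 / p) * s) \<partial>lborel)
      = (\<integral>\<^sup>+s. ennreal (p powr (1 - \<nu>) * exp (- p * u)) * ennreal (indicator {0..} s * s powr (\<nu> - 1) / exp s) \<partial>lborel)"
  proof (rule nn_integral_cong)
    fix s :: real
    show "?g (u + (1 / p) * s) = ennreal (p powr (1 - \<nu>) * exp (- p * u)) * ennreal (indicator {0..} s * s powr (\<nu> - 1) / exp s)"
    proof (cases "s \<ge> 0")
      case True
      have "(s / p) powr (\<nu> - 1) = p powr (1 - \<nu>) * s powr (\<nu> - 1)"
        using True assms powr_minus[of p "\<nu> - 1"] by (simp add: powr_divide) (simp add: field_simps)
      moreover have "exp (- p * (u + (1 / p) * s)) = exp (- p * u) / exp s"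
        using assms by (simp add: ring_distribs exp_diff)
      ultimately show ?thesis using True assms
        by (subst ennreal_mult[symmetric]) (auto simp: mult_ac)
    qed (use assms in \<open>auto simp: field_simps indicator_def\<close>)
  qed
  also have "(\<integral>\<^sup>+s. ennreal (p powr (1 - \<nu>) * exp (- p * u)) * ennreal (indicator {0..} s * s powr (\<nu> - 1) / exp s) \<partial>lborel)
      = ennreal (p powr (1 - \<nu>) * exp (- p * u)) * ennreal (Gamma \<nu>)"
    using assms by (subst nn_integral_cmult) (auto simp: Gamma_conv_nn_integral_real)
  also have "ennreal \<bar>1 / p\<bar> * (ennreal (p powr (1 - \<nu>) * exp (- p * u)) * ennreal (Gamma \<nu>))
     = ennreal ((1 / p * p powr (1 - \<nu>)) * exp (- p * u) * Gamma \<nu>)"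
    using assms Gamma_real_pos[OF assms(1)] by (simp add: ennreal_mult[symmetric] mult_ac)
  also have "1 / p * p powr (1 - \<nu>) = p powr (- \<nu>)"
    using assms powr_add[of p "-1" "1 - \<nu>"] by (simp add: powr_minus divide_inverse)
  finally show ?thesis by (simp add: mult_ac)
qed

text \<open>
  This is the triangle inequality where the integral converges; where it diverges, its value is
  \<open>0\<close> by convention. The passage to extended nonnegative integrals prepares for Tonelli's theorem.
\<close>

lemma rl_integral_le_nn_integral:
  assumes "\<nu> > 0"
  shows "ennreal \<bar>rl_integral \<nu> f t\<bar> \<le> ennreal (1 / Gamma \<nu>) *
    (\<integral>\<^sup>+u. ennreal \<bar>f u\<bar> * ennreal (indicator {0..t} u * (t - u) powr (\<nu> - 1)) \<partial>lborel)"
proof -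
  let ?h = "\<lambda>u. indicat_real {0..t} u *\<^sub>R (f u * (t - u) powr (\<nu> - 1))"
  have "ennreal (norm (integral\<^sup>L lebesgue ?h)) \<le> (\<integral>\<^sup>+u. ennreal (norm (?h u)) \<partial>lebesgue)"
  proof (cases "integrable lebesgue ?h")
    case True then show ?thesis by (rule integral_norm_bound_ennreal)
  qed (simp add: not_integrable_integral_eq)
  also have "\<dots> = (\<integral>\<^sup>+u. ennreal \<bar>f u\<bar> * ennreal (indicator {0..t} u * (t - u) powr (\<nu> - 1)) \<partial>lborel)"
    unfolding nn_integral_completion
    by (intro nn_integral_cong) (simp add: ennreal_mult[symmetric] abs_mult mult_ac)
  finally have "ennreal (1 / Gamma \<nu>) * ennreal (norm (integral\<^sup>L lebesgue ?h)) \<le> ennreal (1 / Gamma \<nu>) *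
    (\<integral>\<^sup>+u. ennreal \<bar>f u\<bar> * ennreal (indicator {0..t} u * (t - u) powr (\<nu> - 1)) \<partial>lborel)"
    by (rule mult_left_mono) simp
  moreover have "\<bar>rl_integral \<nu> f t\<bar> = 1 / Gamma \<nu> * norm (integral\<^sup>L lebesgue ?h)"
    using Gamma_real_pos[OF assms] by (simp add: rl_integral_def set_lebesgue_integral_def abs_mult)
  ultimately show ?thesis
    using Gamma_real_pos[OF assms] by (simp only: ennreal_mult[symmetric] norm_ge_zero
        divide_nonneg_nonneg zero_le_one less_imp_le)
qed

text \<open>
  With \<open>A\<close> the integral of \<open>\<bar>f t\<bar> * exp (- p * t)\<close> over \<open>[0, T]\<close>, the equation, Tonelli's theorem and
  the Laplace integral give \<open>A \<le> \<bar>\<kappa>\<bar> * p powr (- \<nu>) * A\<close>. Local integrability makes \<open>A\<close> finite, so a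
  factor less than one forces \<open>A = 0\<close>.
\<close>

lemma rl_homogeneous_unique:
  fixes \<nu> \<kappa> :: real
  assumes \<nu>: "\<nu> > 0" and li: "locally_integrable_on_halfline f"
    and eq: "\<And>t. t > 0 \<Longrightarrow> f t = \<kappa> * rl_integral \<nu> f t" and T: "T > 0"
  shows "f T = 0"
proof -
  have G: "Gamma \<nu> > 0" using \<nu> by (rule Gamma_real_pos)
  define K where "K = \<bar>\<kappa>\<bar> / Gamma \<nu>"
  have K0: "K \<ge> 0" using G by (simp add: K_def)
  have fi: "integrable lebesgue (\<lambda>x. indicat_real {0..T} x * f x)"
    using li T by (simp add: locally_integrable_on_halfline_def set_integrable_def)
  define g where "g x = ennreal \<bar>indicat_real {0..T} x * f x\<bar>" for x
  have "g \<in> borel_measurable (completion lborel)"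
    unfolding g_def using borel_measurable_integrable[OF fi] by measurable
  \<comment> \<open>Tonelli's theorem is applied to a Borel representative, because the integrand built from
     \<open>f\<close> itself need not be measurable for the product of the Borel sigma-algebras.\<close>
  from completion_ex_borel_measurable[OF this]
  obtain h where h[measurable]: "h \<in> borel_measurable lborel" and gh: "AE x in lborel. g x = h x"
    by auto
  have fin: "(\<integral>\<^sup>+x. h x \<partial>lborel) < \<infinity>"
  proof -
    have "(\<integral>\<^sup>+x. h x \<partial>lborel) = (\<integral>\<^sup>+x. g x \<partial>lborel)"
      using gh by (intro nn_integral_cong_AE) auto
    also have "\<dots> = (\<integral>\<^sup>+x. ennreal (norm (indicat_real {0..T} x * f x)) \<partial>lebesgue)"
      by (simp add: nn_integral_completion g_def)
    also have "\<dots> < \<infinity>" using fi by (simp add: integrable_iff_bounded)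
    finally show ?thesis .
  qed
  define k where "k t u = ennreal (indicator {u..} t * (t - u) powr (\<nu> - 1))" for t u :: real
  have k[measurable]: "(\<lambda>(t,u). k t u) \<in> borel_measurable (lborel \<Otimes>\<^sub>M lborel)"
  proof -
    have "k t u = ennreal ((if u \<le> t then 1 else 0) * (t - u) powr (\<nu> - 1))" for t u
      by (simp add: k_def)
    then show ?thesis by simp
  qed
  \<comment> \<open>Chosen so that \<open>\<bar>\<kappa>\<bar> * p powr (- \<nu>) < 1 / 2\<close>; the summand one keeps \<open>p\<close> positive when \<open>\<kappa> = 0\<close>.\<close>
  define p where "p = (2 * \<bar>\<kappa>\<bar> + 1) powr (1 / \<nu>)"
  have p: "p > 0" "p powr (- \<nu>) = 1 / (2 * \<bar>\<kappa>\<bar> + 1)"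
    using \<nu> by (auto simp: p_def powr_powr powr_minus divide_inverse)
  define w where "w t = ennreal (exp (- p * t))" for t
  have w[measurable]: "w \<in> borel_measurable lborel" unfolding w_def by measurable
  have bound: "AE t in lborel. h t \<le> ennreal K * (\<integral>\<^sup>+u. h u * k t u \<partial>lborel)"
    using gh AE_lborel_singleton[of 0]
  proof eventually_elim
    case (elim t)
    show ?case
    proof (cases "t \<in> {0..T}")
      case True
      with elim have t: "0 < t" "t \<le> T" by auto
      have "h t = ennreal \<bar>\<kappa>\<bar> * ennreal \<bar>rl_integral \<nu> f t\<bar>"
        using elim t eq[OF t(1)] by (simp add: g_def ennreal_mult[symmetric] abs_mult flip: elim(1))
      also have "\<dots> \<le> ennreal \<bar>\<kappa>\<bar> * (ennreal (1 / Gamma \<nu>) *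
          (\<integral>\<^sup>+u. ennreal \<bar>f u\<bar> * ennreal (indicator {0..t} u * (t - u) powr (\<nu> - 1)) \<partial>lborel))"
        by (intro mult_left_mono rl_integral_le_nn_integral \<nu>) simp
      also have "\<dots> = ennreal K * (\<integral>\<^sup>+u. ennreal \<bar>f u\<bar> * ennreal (indicator {0..t} u * (t - u) powr (\<nu> - 1)) \<partial>lborel)"
        using G by (simp add: K_def ennreal_mult[symmetric] mult.assoc[symmetric])
      also have "(\<integral>\<^sup>+u. ennreal \<bar>f u\<bar> * ennreal (indicator {0..t} u * (t - u) powr (\<nu> - 1)) \<partial>lborel)
          \<le> (\<integral>\<^sup>+u. h u * k t u \<partial>lborel)"
      proof (rule nn_integral_mono_AE)
        show "AE u in lborel. ennreal \<bar>f u\<bar> * ennreal (indicator {0..t} u * (t - u) powr (\<nu> - 1)) \<le> h u * k t u"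
          using gh
        proof eventually_elim
          case (elim u)
          show ?case
          proof (cases "u \<in> {0..t}")
            case True
            then show ?thesis using t by (simp add: g_def k_def flip: elim)
          qed auto
        qed
      qed
      finally show ?thesis by (simp add: mult_left_mono)
    next
      case False
      then show ?thesis by (simp add: g_def flip: elim(1))
    qed
  qed
  define A where "A = (\<integral>\<^sup>+t. h t * w t \<partial>lborel)"
  have h0: "AE t in lborel. t < 0 \<longrightarrow> h t = 0"
    using gh by eventually_elim (auto simp: g_def)
  have "A \<le> (\<integral>\<^sup>+t. h t \<partial>lborel)"
    unfolding A_def
  proof (rule nn_integral_mono_AE)
    show "AE t in lborel. h t * w t \<le> h t" using h0
    proof eventually_elim
      case (elim t)
      show ?case
      proof (cases "t < 0")
        case False
        then have "w t \<le> 1" using p by (simp add: w_def)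
        then have "h t * w t \<le> h t * 1" by (intro mult_left_mono) auto
        then show ?thesis by simp
      qed (use elim in simp)
    qed
  qed
  with fin have A_fin: "A < \<infinity>" by (metis le_less_trans)
  have "A \<le> (\<integral>\<^sup>+t. (ennreal K * (\<integral>\<^sup>+u. h u * k t u \<partial>lborel)) * w t \<partial>lborel)"
    unfolding A_def using bound
    by (intro nn_integral_mono_AE) (auto elim!: eventually_mono intro: mult_right_mono)
  also have "\<dots> = ennreal K * (\<integral>\<^sup>+t. (\<integral>\<^sup>+u. h u * k t u * w t \<partial>lborel) \<partial>lborel)"
    by (simp add: nn_integral_multc) (simp add: nn_integral_cmult mult.assoc)
  also have "(\<integral>\<^sup>+t. (\<integral>\<^sup>+u. h u * k t u * w t \<partial>lborel) \<partial>lborel) = (\<integral>\<^sup>+u. (\<integral>\<^sup>+t. h u * k t u * w t \<partial>lborel) \<partial>lborel)"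
    by (rule lborel_pair.Fubini') measurable
  also have "\<dots> = (\<integral>\<^sup>+u. h u * (\<integral>\<^sup>+t. k t u * w t \<partial>lborel) \<partial>lborel)"
    by (simp add: nn_integral_cmult mult.assoc)
  also have "\<dots> = (\<integral>\<^sup>+u. ennreal (Gamma \<nu> * p powr (- \<nu>)) * (h u * w u) \<partial>lborel)"
  proof (rule nn_integral_cong)
    fix u :: real
    have "(\<integral>\<^sup>+t. k t u * w t \<partial>lborel) = ennreal (Gamma \<nu> * p powr (- \<nu>) * exp (- p * u))"
      unfolding nn_integral_Laplace_power[OF \<nu> p(1), symmetric]
      by (intro nn_integral_cong) (simp add: k_def w_def ennreal_mult[symmetric] mult.assoc)
    also have "\<dots> = ennreal (Gamma \<nu> * p powr (- \<nu>)) * w u"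
      using G by (simp add: w_def ennreal_mult)
    finally show "h u * (\<integral>\<^sup>+t. k t u * w t \<partial>lborel) = ennreal (Gamma \<nu> * p powr (- \<nu>)) * (h u * w u)"
      by (simp add: mult_ac)
  qed
  also have "\<dots> = ennreal (Gamma \<nu> * p powr (- \<nu>)) * A"
    unfolding A_def by (rule nn_integral_cmult) measurable
  also have "ennreal K * \<dots> = ennreal (K * (Gamma \<nu> * p powr (- \<nu>))) * A"
    using K0 G by (simp add: ennreal_mult mult.assoc)
  also have "K * (Gamma \<nu> * p powr (- \<nu>)) = \<bar>\<kappa>\<bar> / (2 * \<bar>\<kappa>\<bar> + 1)"
    unfolding p(2) using G by (simp add: K_def)
  finally have A_le: "A \<le> ennreal (\<bar>\<kappa>\<bar> / (2 * \<bar>\<kappa>\<bar> + 1)) * A" .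
  obtain r where r: "r \<ge> 0" "A = ennreal r" using A_fin by (cases A) auto
  have "r \<le> \<bar>\<kappa>\<bar> / (2 * \<bar>\<kappa>\<bar> + 1) * r"
    using A_le r by (simp add: ennreal_mult[symmetric])
  moreover have "\<bar>\<kappa>\<bar> / (2 * \<bar>\<kappa>\<bar> + 1) \<le> 1 / 2" by (simp add: field_simps)
  ultimately have "r \<le> 1 / 2 * r" using r(1) by (meson mult_right_mono order_trans)
  with r have "A = 0" by simp
  then have "AE t in lborel. h t * w t = 0"
    unfolding A_def by (subst (asm) nn_integral_0_iff_AE) auto
  with gh have "AE t in lborel. g t = 0" by eventually_elim (simp add: w_def)
  then have f0: "AE t in lborel. t \<in> {0..T} \<longrightarrow> f t = 0"
    by eventually_elim (auto simp: g_def)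
  \<comment> \<open>The integral at \<open>T\<close> sees \<open>f\<close> only up to null sets, so the equation recovers the pointwise value.\<close>
  have "(\<integral>\<^sup>+u. ennreal \<bar>f u\<bar> * ennreal (indicator {0..T} u * (T - u) powr (\<nu> - 1)) \<partial>lborel) = (\<integral>\<^sup>+u. 0 \<partial>(lborel::real measure))"
    using f0 by (intro nn_integral_cong_AE, eventually_elim) (auto simp: indicator_def)
  with rl_integral_le_nn_integral[OF \<nu>, of f T] have "rl_integral \<nu> f T = 0" by simp
  with eq[OF T] show ?thesis by simp
qed

section \<open>The fractional kinetic equation\<close>

theorem theorem2:
  fixes \<nu> c d \<mu> N0 :: real and N :: "real \<Rightarrow> real"
  assumes "\<nu> > 0" "c > 0" "d > 0" "\<mu> > 0" "c \<noteq> d"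
  shows "(locally_integrable_on_halfline N \<and>
          (\<forall>t>0. rl_integral_exists \<nu> N t \<and>
             N t - N0 * t powr (\<mu> - 1) * mittag_leffler \<nu> \<mu> (- (d powr \<nu> * t powr \<nu>))
               = - (c powr \<nu>) * rl_integral \<nu> N t))
     \<longleftrightarrow> (\<forall>t>0. N t = N0 * (t powr (\<mu> - \<nu> - 1) / (c powr \<nu> - d powr \<nu>)) *
             (mittag_leffler \<nu> (\<mu> - \<nu>) (- (d powr \<nu> * t powr \<nu>))
              - mittag_leffler \<nu> (\<mu> - \<nu>) (- (c powr \<nu> * t powr \<nu>))))"
    (is "?solves \<longleftrightarrow> ?formula")
proof -
  define C D where "C = c powr \<nu>" and "D = d powr \<nu>"
  have CD: "C \<noteq> D"
    using assms powr_less_mono2[of \<nu> c d] powr_less_mono2[of \<nu> d c] by (auto simp: C_def D_def neq_iff)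
  define a where "a = N0 / (C - D)"
  have a: "a * (C - D) = N0" using CD by (simp add: a_def)
  let ?e = "mittag_leffler_kernel \<nu>"
  define M where "M t = a * C * ?e \<mu> (- C) t + (- a * D) * ?e \<mu> (- D) t" for t
  have M_exists: "rl_integral_exists \<kappa> M t" if "\<kappa> > 0" "t > 0" for \<kappa> t
    unfolding M_def using assms that by (intro rl_integral_lincomb rl_integral_mittag_leffler_kernel)
  have M_loc: "locally_integrable_on_halfline M"
    by (simp add: locally_integrable_on_halfline_iff_rl M_exists)
  have M_eq: "M t - N0 * ?e \<mu> (- D) t = - C * rl_integral \<nu> M t" if t: "t > 0" for t
  proof -
    let ?p = "t powr (\<mu> - 1) * rGamma \<mu>"
    have "rl_integral \<nu> M t = a * C * ?e (\<mu> + \<nu>) (- C) t + (- a * D) * ?e (\<mu> + \<nu>) (- D) t"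
      unfolding M_def using assms t
      by (simp only: rl_integral_lincomb(2) rl_integral_mittag_leffler_kernel)
    moreover have "?e \<mu> (- C) t = ?p - C * ?e (\<mu> + \<nu>) (- C) t" "?e \<mu> (- D) t = ?p - D * ?e (\<mu> + \<nu>) (- D) t"
      using mittag_leffler_kernel_shift[OF assms(1) t, of "\<mu> + \<nu>"] by simp_all
    ultimately have R: "rl_integral \<nu> M t = a * (?e \<mu> (- D) t - ?e \<mu> (- C) t)"
      by (simp only:) (simp add: algebra_simps)
    have "M t - a * (C - D) * ?e \<mu> (- D) t = - C * (a * (?e \<mu> (- D) t - ?e \<mu> (- C) t))"
      by (simp add: M_def algebra_simps)
    then show ?thesis unfolding R a .
  qed
  have formula: "?formula \<longleftrightarrow> (\<forall>t>0. N t = M t)"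
  proof -
    have "N0 * (t powr (\<mu> - \<nu> - 1) / (c powr \<nu> - d powr \<nu>)) *
             (mittag_leffler \<nu> (\<mu> - \<nu>) (- (d powr \<nu> * t powr \<nu>))
              - mittag_leffler \<nu> (\<mu> - \<nu>) (- (c powr \<nu> * t powr \<nu>))) = M t" (is "?l = _") if t: "t > 0" for t
    proof -
      have "?l = a * (?e (\<mu> - \<nu>) (- D) t - ?e (\<mu> - \<nu>) (- C) t)"
        by (simp add: mittag_leffler_kernel_def a_def C_def D_def algebra_simps diff_divide_distrib)
      also have "\<dots> = M t"
        unfolding mittag_leffler_kernel_shift[OF assms(1) t] M_def by (simp add: algebra_simps)
      finally show ?thesis .
    qed
    then show ?thesis by auto
  qed
  have source: "N0 * t powr (\<mu> - 1) * mittag_leffler \<nu> \<mu> (- (d powr \<nu> * t powr \<nu>)) = N0 * ?e \<mu> (- D) t" for t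
    by (simp add: mittag_leffler_kernel_def D_def)
  show ?thesis
    unfolding formula source
  proof (intro iffI conjI allI impI)
    assume N: "locally_integrable_on_halfline N \<and>
      (\<forall>t>0. rl_integral_exists \<nu> N t \<and> N t - N0 * ?e \<mu> (- D) t = - (c powr \<nu>) * rl_integral \<nu> N t)"
    fix t :: real assume t: "t > 0"
    \<comment> \<open>Written as a linear combination so that it has the shape required by linearity.\<close>
    let ?f = "\<lambda>u. 1 * N u + (- 1) * M u"
    have "locally_integrable_on_halfline ?f"
      using N M_loc unfolding locally_integrable_on_halfline_iff_rl by (blast intro: rl_integral_lincomb(1))
    moreover have "?f s = - C * rl_integral \<nu> ?f s" if s: "s > 0" for s
    proof -
      have "rl_integral_exists \<nu> N s" "N s - N0 * ?e \<mu> (- D) s = - C * rl_integral \<nu> N s"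
        using N s by (auto simp: C_def)
      then have "N s - M s = - C * (rl_integral \<nu> N s - rl_integral \<nu> M s)"
        using M_eq[OF s] by (simp add: algebra_simps)
      moreover have "rl_integral \<nu> ?f s = 1 * rl_integral \<nu> N s + (- 1) * rl_integral \<nu> M s"
        by (rule rl_integral_lincomb(2)[OF \<open>rl_integral_exists \<nu> N s\<close> M_exists[OF assms(1) s]])
      ultimately show ?thesis by simp
    qed
    ultimately have "?f t = 0" by (rule rl_homogeneous_unique[OF assms(1) _ _ t])
    then show "N t = M t" by simp
  next
    assume NM: "\<forall>t>0. N t = M t"
    have N_exists: "rl_integral_exists \<kappa> N t" "rl_integral \<kappa> N t = rl_integral \<kappa> M t" if "\<kappa> > 0" "t > 0" for \<kappa> t
      using rl_integral_cong[OF M_exists[OF that], of N] NM by auto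
    show "locally_integrable_on_halfline N"
      by (simp add: locally_integrable_on_halfline_iff_rl N_exists)
    fix t :: real assume t: "t > 0"
    show "rl_integral_exists \<nu> N t" by (rule N_exists[OF assms(1) t])
    show "N t - N0 * ?e \<mu> (- D) t = - (c powr \<nu>) * rl_integral \<nu> N t"
      using M_eq[OF t] NM t N_exists(2)[OF assms(1) t] by (simp add: C_def)
  qed
qed

end
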